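(* Let $u_{\max}>0$ and let $f:[0,u_{\max}]\to\mathbb{R}_+$ be $\mathcal{C}^2$ and strictly concave, with $f''<0$ and $f(0)=f(u_{\max})=0$; let $\hat u\in(0,u_{\max})$ be its unique maximizer, and let $u^*\in[0,u_{\max}]$. Define $$\mathcal{C}_a=\{v\in[0,u_{\max}]:(v-u^* )f''(v)+f'(v)\ge 0\},\quad \mathcal{C}_b=\{v\in[0,u_{\max}]:(v-u^* )f''(v)+f'(v)\le 0\},$$ $$\mathcal{I}_a=\{v\in[0,u_{\max}]:vf''(v)+f'(v)\ge 0\},\quad \mathcal{I}_b=\{v\in[0,u_{\max}]:vf''(v)+f'(v)\le 0\}.$$ Then: (i) $0\in\mathcal{C}_a$ and $0\in\mathcal{I}_a$; (ii) $u_{\max}\in\mathcal{C}_b$ and $u_{\max}\in\mathcal{I}_b$; (iii) $\hat u\in\mathcal{C}_a$ if and only if $\hat u\le u^*$, and $\hat u\in\mathcal{C}_b$ if and only if $\hat u\ge u^*$; (iv) $\hat u\notin\mathcal{I}_a$ and $\hat u\in\mathcal{I}_b$, regardless of $u^*$.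
   Context: All objects are defined in the claim. *)

theory Defs
  imports "HOL-Analysis.Analysis"
begin

definition strictly_concave_on :: "real set \<Rightarrow> (real \<Rightarrow> real) \<Rightarrow> bool" where
  "strictly_concave_on S f \<longleftrightarrow> convex S \<and>
     (\<forall>x\<in>S. \<forall>y\<in>S. \<forall>t. x \<noteq> y \<longrightarrow> 0 < t \<longrightarrow> t < 1 \<longrightarrow>
        (1 - t) * f x + t * f y < f ((1 - t) * x + t * y))"

(* C^2 on S with first and second derivative f' and f''.  Derivatives are taken within S,
   so they are one-sided at the endpoints of an interval; on a nondegenerate interval
   f' and f'' are uniquely determined on S by f. *)
definition C2_with_derivs_on ::
  "real set \<Rightarrow> (real \<Rightarrow> real) \<Rightarrow> (real \<Rightarrow> real) \<Rightarrow> (real \<Rightarrow> real) \<Rightarrow> bool" where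
  "C2_with_derivs_on S f f' f'' \<longleftrightarrow>
     (\<forall>v\<in>S. (f has_real_derivative f' v) (at v within S)) \<and>
     (\<forall>v\<in>S. (f' has_real_derivative f'' v) (at v within S)) \<and>
     continuous_on S f''"

definition is_unique_maximizer_on :: "real set \<Rightarrow> (real \<Rightarrow> real) \<Rightarrow> real \<Rightarrow> bool" where
  "is_unique_maximizer_on S f u \<longleftrightarrow>
     is_arg_max f (\<lambda>v. v \<in> S) u \<and> (\<forall>w. is_arg_max f (\<lambda>v. v \<in> S) w \<longrightarrow> w = u)"

definition C_a :: "real \<Rightarrow> real \<Rightarrow> (real \<Rightarrow> real) \<Rightarrow> (real \<Rightarrow> real) \<Rightarrow> real set" where
  "C_a u_max u_star f' f'' = {v \<in> {0..u_max}. (v - u_star) * f'' v + f' v \<ge> 0}"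

definition C_b :: "real \<Rightarrow> real \<Rightarrow> (real \<Rightarrow> real) \<Rightarrow> (real \<Rightarrow> real) \<Rightarrow> real set" where
  "C_b u_max u_star f' f'' = {v \<in> {0..u_max}. (v - u_star) * f'' v + f' v \<le> 0}"

definition I_a :: "real \<Rightarrow> (real \<Rightarrow> real) \<Rightarrow> (real \<Rightarrow> real) \<Rightarrow> real set" where
  "I_a u_max f' f'' = {v \<in> {0..u_max}. v * f'' v + f' v \<ge> 0}"

definition I_b :: "real \<Rightarrow> (real \<Rightarrow> real) \<Rightarrow> (real \<Rightarrow> real) \<Rightarrow> real set" where
  "I_b u_max f' f'' = {v \<in> {0..u_max}. v * f'' v + f' v \<le> 0}"

end

theory Submission
  imports Defs
begin

text \<open>The two endpoints of \<open>{0..u_max}\<close> are minimizers of \<open>f\<close> and \<open>u_hat\<close> is an interior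
  maximizer, so \<open>f' 0 \<ge> 0\<close>, \<open>f' u_max \<le> 0\<close> and \<open>f' u_hat = 0\<close>. Since \<open>f'' < 0\<close>, the term
  \<open>(v - w) * f'' v\<close> (with \<open>w = u_star\<close> or \<open>w = 0\<close>) has the sign of \<open>w - v\<close>, which at the endpoints
  does not conflict with that of \<open>f' v\<close>, and at \<open>u_hat\<close> decides alone.\<close>

text \<open>A negative one-sided derivative would force values below \<open>f a\<close> just to the
  right of \<open>a\<close>.\<close>

lemma deriv_nonneg_at_left_endpoint_min:
  fixes f :: "real \<Rightarrow> real"
  assumes "a < b" and "(f has_real_derivative D) (at a within {a..b})"
    and min: "\<And>x. x \<in> {a..b} \<Longrightarrow> f a \<le> f x"
  shows "0 \<le> D"
proof (rule ccontr)
  assume "\<not> 0 \<le> D"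
  then obtain d where "d > 0"
    and d: "\<And>h. 0 < h \<Longrightarrow> a + h \<in> {a..b} \<Longrightarrow> h < d \<Longrightarrow> f (a + h) < f a"
    using has_real_derivative_neg_dec_right[OF assms(2)] by auto
  \<comment> \<open>Halving \<open>d\<close> keeps \<open>h\<close> strictly below \<open>d\<close>;
    the cap \<open>b - a\<close> keeps \<open>a + h\<close> in the interval.\<close>
  define h where "h = min (d / 2) (b - a)"
  have h: "0 < h" "h < d" "a + h \<in> {a..b}"
    using \<open>d > 0\<close> \<open>a < b\<close> by (auto simp: h_def)
  show False
    using d[OF h(1,3,2)] min[OF h(3)] by simp
qed

lemma deriv_nonpos_at_right_endpoint_min:
  fixes f :: "real \<Rightarrow> real"
  assumes "a < b" and "(f has_real_derivative D) (at b within {a..b})"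
    and min: "\<And>x. x \<in> {a..b} \<Longrightarrow> f b \<le> f x"
  shows "D \<le> 0"
proof (rule ccontr)
  assume "\<not> D \<le> 0"
  then obtain d where "d > 0"
    and d: "\<And>h. 0 < h \<Longrightarrow> b - h \<in> {a..b} \<Longrightarrow> h < d \<Longrightarrow> f (b - h) < f b"
    using has_real_derivative_pos_inc_left[OF assms(2)] by auto
  define h where "h = min (d / 2) (b - a)"
  have h: "0 < h" "h < d" "b - h \<in> {a..b}"
    using \<open>d > 0\<close> \<open>a < b\<close> by (auto simp: h_def)
  show False
    using d[OF h(1,3,2)] min[OF h(3)] by simp
qed

text \<open>At an interior point the derivative within \<open>{a..b}\<close> is the two-sided one,
  so Fermat's criterion applies.\<close>

lemma deriv_zero_at_interior_max:
  fixes f :: "real \<Rightarrow> real"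
  assumes "u \<in> {a<..<b}" and "(f has_real_derivative D) (at u within {a..b})"
    and max: "\<And>x. x \<in> {a..b} \<Longrightarrow> f x \<le> f u"
  shows "D = 0"
proof (rule DERIV_local_max)
  show "(f has_real_derivative D) (at u)"
    using assms(1,2) by (simp add: at_within_Icc_at)
  \<comment> \<open>The radius is the distance to the nearer endpoint, so the neighbourhood stays
    inside \<open>{a..b}\<close>.\<close>
  show "0 < min (u - a) (b - u)"
    using assms(1) by simp
  show "\<forall>y. \<bar>u - y\<bar> < min (u - a) (b - u) \<longrightarrow> f y \<le> f u"
    using max by (auto simp: abs_if split: if_splits)
qed

theorem mainTheorem3:
  fixes u_max u_hat u_star :: real
    and f f' f'' :: "real \<Rightarrow> real"
  assumes "u_max > 0"
    and "\<forall>v\<in>{0..u_max}. f v \<ge> 0"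
    and "C2_with_derivs_on {0..u_max} f f' f''"
    and "strictly_concave_on {0..u_max} f"
    and "\<forall>v\<in>{0..u_max}. f'' v < 0"
    and "f 0 = 0" and "f u_max = 0"
    and "u_hat \<in> {0<..<u_max}"
    and "is_unique_maximizer_on {0..u_max} f u_hat"
    and "u_star \<in> {0..u_max}"
  shows "(0 \<in> C_a u_max u_star f' f'' \<and> 0 \<in> I_a u_max f' f'') \<and>
    (u_max \<in> C_b u_max u_star f' f'' \<and> u_max \<in> I_b u_max f' f'') \<and>
    ((u_hat \<in> C_a u_max u_star f' f'' \<longleftrightarrow> u_hat \<le> u_star) \<and>
     (u_hat \<in> C_b u_max u_star f' f'' \<longleftrightarrow> u_hat \<ge> u_star)) \<and>
    (u_hat \<notin> I_a u_max f' f'' \<and> u_hat \<in> I_b u_max f' f'')"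
proof -
  have der: "(f has_real_derivative f' v) (at v within {0..u_max})" if "v \<in> {0..u_max}" for v
    using assms(3) that by (simp add: C2_with_derivs_on_def)
  \<comment> \<open>Both endpoints are minimizers because \<open>f\<close> is nonnegative and
    vanishes there.\<close>
  have d0: "f' 0 \<ge> 0"
    by (rule deriv_nonneg_at_left_endpoint_min[OF assms(1) der]) (use assms(1,2,6) in auto)
  have dm: "f' u_max \<le> 0"
    by (rule deriv_nonpos_at_right_endpoint_min[OF assms(1) der]) (use assms(1,2,7) in auto)
  have le_max: "f x \<le> f u_hat" if "x \<in> {0..u_max}" for x
    using assms(9) that by (auto simp: is_unique_maximizer_on_def is_arg_max_linorder)
  have dh: "f' u_hat = 0"
    by (rule deriv_zero_at_interior_max[OF assms(8) der le_max]) (use assms(8) in auto)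
  have neg: "f'' 0 < 0" "f'' u_max < 0" "f'' u_hat < 0"
    using assms(1,5,8) by auto
  \<comment> \<open>At \<open>v = 0\<close> the term for \<open>C_a\<close> is
    \<open>- (u_star * f'' 0)\<close>, and the one for \<open>I_a\<close> vanishes.\<close>
  have "u_star * f'' 0 \<le> 0" "(u_max - u_star) * f'' u_max \<le> 0" "u_max * f'' u_max \<le> 0"
    using assms(1,10) neg by (auto intro!: mult_nonneg_nonpos)
  \<comment> \<open>Strictness, from \<open>u_hat > 0\<close>, is what excludes \<open>u_hat\<close>
    from \<open>I_a\<close>.\<close>
  moreover have "u_hat * f'' u_hat < 0"
    using assms(8) neg(3) by (simp add: mult_pos_neg)
  \<comment> \<open>Dividing by the negative \<open>f'' u_hat\<close> reverses the inequality; as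
    \<open>f' u_hat = 0\<close>, these are the membership conditions of \<open>C_a\<close> and
    \<open>C_b\<close>.\<close>
  moreover have "(u_hat - u_star) * f'' u_hat \<ge> 0 \<longleftrightarrow> u_hat \<le> u_star"
    "(u_hat - u_star) * f'' u_hat \<le> 0 \<longleftrightarrow> u_hat \<ge> u_star"
    using neg(3) by (auto simp: zero_le_mult_iff mult_le_0_iff)
  ultimately show ?thesis
    using assms(1,8) d0 dm dh by (auto simp: C_a_def C_b_def I_a_def I_b_def)
qed

end
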